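(* Let $G=(V,E)$ be a simple graph with minimum vertex degree $\geq 2$ and maximum vertex degree $\Delta$. Then, the spectral gap from $1$ for the non-backtracking Laplacian $\mathcal{L}$ of $G$, that is, $\varepsilon := \min_{\lambda\in\sigma(\mathcal{L})}|1-\lambda|$, where $\sigma(\mathcal{L})\subset\mathbb{C}$ denotes the spectrum of $\mathcal{L}$, satisfies $$\varepsilon \geq \frac{1}{\Delta-1}.$$ Moreover, the bound is sharp.
   Context: Let $G=(V,E)$ be a finite simple undirected graph with minimum degree $\ge 2$. An oriented edge of $G$ is an ordered pair $e=[v,w]$ of adjacent vertices, with input $v$ and output $w$; if $G$ has $M$ edges it has $2M$ oriented edges. The non-backtracking graph $\mathcal{NB}(G)$ is the directed graph whose vertices are the $2M$ oriented edges of $G$, with a directed edge $e\to e'$ if and only if the output of $e$ equals the input of $e'$ and the input of $e$ differs from the output of $e'$. Each vertex $e=[v,w]$ of $\mathcal{NB}(G)$ has outdegree $\deg_G w-1\ge 1$. Let $\mathcal{A}$ be the $2M\times 2M$ adjacency matrix of $\mathcal{NB}(G)$ ($\mathcal{A}_{e,e'}=1$ if $e\to e'$, and $0$ otherwise) and $\mathcal{D}$ the diagonal matrix of outdegrees. The non-backtracking Laplacian of $G$ is $\mathcal{L}=\mathrm{Id}-\mathcal{D}^{-1}\mathcal{A}$, where $\mathrm{Id}$ is the $2M\times 2M$ identity matrix. *)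

theory Defs
  imports
    "Graph_Theory.Pair_Digraph"
    "Jordan_Normal_Form.Gauss_Jordan_Elimination"
    "Jordan_Normal_Form.Spectral_Radius"
begin

(* A finite simple undirected graph is a term G with "pair_graph G": a finite loopless symmetric
   relation "parcs G" on "pverts G". Each undirected edge contributes both (v, w) and (w, v), so
   "parcs G" is the set of the 2M oriented edges, with fst the input and snd the output, and
   "out_degree G v" is the number of neighbours of v. *)

definition min_degree :: "'a pair_pre_digraph \<Rightarrow> nat" where
  "min_degree G = Min (out_degree (with_proj G) ` pverts G)"

definition max_degree :: "'a pair_pre_digraph \<Rightarrow> nat" where
  "max_degree G = Max (out_degree (with_proj G) ` pverts G)"

definition nb_graph :: "'a pair_pre_digraph \<Rightarrow> ('a \<times> 'a) pair_pre_digraph" where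
  "nb_graph G =
     \<lparr> pverts = parcs G,
       parcs = {(e, e'). e \<in> parcs G \<and> e' \<in> parcs G \<and> snd e = fst e' \<and> fst e \<noteq> snd e'} \<rparr>"

(* The matrices below have rows and columns indexed by positions in a list vs. The list is meant
   to enumerate the vertices of the digraph without repetition; another enumeration only
   conjugates them by a permutation matrix. *)

definition adjacency_matrix :: "'v list \<Rightarrow> 'v pair_pre_digraph \<Rightarrow> complex mat" where
  "adjacency_matrix vs H =
     mat (length vs) (length vs) (\<lambda>(i, j). if (vs ! i, vs ! j) \<in> parcs H then 1 else 0)"

definition outdegree_matrix :: "'v list \<Rightarrow> 'v pair_pre_digraph \<Rightarrow> complex mat" where
  "outdegree_matrix vs H =
     mat (length vs) (length vs)
       (\<lambda>(i, j). if i = j then of_nat (out_degree (with_proj H) (vs ! i)) else 0)"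

(* The option-valued mat_inverse returns the inverse matrix exactly when all outdegrees are
   positive; for nb_graph G this is the case whenever G has minimum degree at least 2. *)

definition nb_laplacian :: "('a \<times> 'a) list \<Rightarrow> 'a pair_pre_digraph \<Rightarrow> complex mat" where
  "nb_laplacian es G =
     1\<^sub>m (length es) -
       the (mat_inverse (outdegree_matrix es (nb_graph G))) * adjacency_matrix es (nb_graph G)"

definition spectral_gap_from_1 :: "complex mat \<Rightarrow> real" where
  "spectral_gap_from_1 A = Min ((\<lambda>l. cmod (1 - l)) ` spectrum A)"

end

theory Submission
  imports Defs
begin

text \<open>
  Put \<open>\<mu> = 1 - \<lambda>\<close>. An eigenfunction satisfies \<open>S w - f (w, v) = \<mu> (deg w - 1) f (v, w)\<close> on every
  arc, where \<open>S w\<close> is the sum of \<open>f\<close> over the arcs leaving \<open>w\<close>. So around each vertex \<open>w\<close> the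
  matrix \<open>J - I\<close>, whose singular values are \<open>deg w - 1\<close> and \<open>1\<close>, sends the outgoing values of \<open>f\<close>
  to \<open>\<mu> (deg w - 1)\<close> times the incoming ones; it does not decrease the Euclidean norm. Summing the
  squared norms over \<open>w\<close>, both sides run over all arcs, whence \<open>1 \<le> \<bar>\<mu>\<bar> (\<Delta> - 1)\<close>. Equality holds for
  the complete graph on \<open>\<Delta> + 1\<close> vertices, with the unit circulation along a triangle.
\<close>

section \<open>The norm inequality at a single vertex\<close>

text \<open>Expanding the squares, the right side exceeds the left by exactly
  \<open>(real (card N) - 2) * (cmod S)\<^sup>2\<close>, where \<open>S\<close> is the total of
  \<open>g\<close>. In particular \<open>S = 0\<close> gives equality.\<close>

lemma sum_norm_square_le_sum_minus:
  fixes g :: "'b \<Rightarrow> complex"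
  assumes "2 \<le> card N"
  shows "(\<Sum>x\<in>N. (cmod (g x))\<^sup>2) \<le> (\<Sum>x\<in>N. (cmod (sum g N - g x))\<^sup>2)"
proof -
  define S where "S = sum g N"
  have pt: "(cmod (S - z))\<^sup>2 = (cmod S)\<^sup>2 + (cmod z)\<^sup>2 - 2 * (Re S * Re z + Im S * Im z)" for z
    unfolding cmod_power2 by (simp add: power2_eq_square algebra_simps)
  have "(\<Sum>x\<in>N. (cmod (S - g x))\<^sup>2) = real (card N) * (cmod S)\<^sup>2 + (\<Sum>x\<in>N. (cmod (g x))\<^sup>2)
      - 2 * (Re S * (\<Sum>x\<in>N. Re (g x)) + Im S * (\<Sum>x\<in>N. Im (g x)))"
    unfolding pt by (simp add: sum.distrib sum_subtractf sum_distrib_left)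
  also have "\<dots> = (real (card N) - 2) * (cmod S)\<^sup>2 + (\<Sum>x\<in>N. (cmod (g x))\<^sup>2)"
  proof -
    have "(\<Sum>x\<in>N. Re (g x)) = Re S" "(\<Sum>x\<in>N. Im (g x)) = Im S"
      by (simp_all add: S_def)
    moreover have "(cmod S)\<^sup>2 = Re S * Re S + Im S * Im S"
      unfolding cmod_power2 by (simp add: power2_eq_square)
    ultimately show ?thesis by (simp add: algebra_simps)
  qed
  finally show ?thesis
    using assms by (simp add: S_def)
qed

section \<open>Eigenfunctions on arcs, and the arcs of the non-backtracking graph\<close>

text \<open>This is the eigenvalue equation of the Laplacian at \<open>1 - \<mu>\<close>, with the
  inverse of the outdegree matrix cleared. A function on pairs carries no enumeration of the arcs;
  only its values on arcs matter, so nonvanishing is asked there.\<close>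

definition nb_eigenfun :: "'a pair_pre_digraph \<Rightarrow> complex \<Rightarrow> ('a \<times> 'a \<Rightarrow> complex) \<Rightarrow> bool" where
  "nb_eigenfun G \<mu> f \<longleftrightarrow> (\<exists>e\<in>parcs G. f e \<noteq> 0) \<and>
     (\<forall>e\<in>parcs G. sum f (out_arcs G (snd e) - {prod.swap e}) =
        \<mu> * of_nat (out_degree G (snd e) - 1) * f e)"

context pair_graph
begin

lemma swap_in_parcs: "e \<in> parcs G \<Longrightarrow> prod.swap e \<in> parcs G"
  using sym_arcs by (cases e) (auto simp: symmetric_def sym_def)

lemma swap_parcs: "prod.swap ` parcs G = parcs G"
proof
  show "parcs G \<subseteq> prod.swap ` parcs G"
    using swap_in_parcs by (metis image_eqI subsetI swap_swap)
qed (use swap_in_parcs in auto)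

lemma swap_in_out_arcs: "e \<in> parcs G \<Longrightarrow> prod.swap e \<in> out_arcs G (snd e)"
  using swap_in_parcs by (auto simp: out_arcs_def)

lemma finite_out_arcs_with_proj: "finite (out_arcs (with_proj G) v)"
  using pair_finite_arcs by (simp add: out_arcs_def)

text \<open>Among the arcs leaving \<open>snd e\<close>, the condition
  \<open>fst e \<noteq> snd e'\<close> excludes exactly the reversal of \<open>e\<close>.\<close>

lemma out_arcs_nb_graph:
  assumes "e \<in> parcs G"
  shows "out_arcs (with_proj (nb_graph G)) e = Pair e ` (out_arcs G (snd e) - {prod.swap e})"
  using assms by (auto simp: out_arcs_def nb_graph_def prod.swap_def prod_eq_iff image_iff)

text \<open>By symmetry of \<open>G\<close> the reversal of \<open>e\<close> is itself an arc
  leaving \<open>snd e\<close>, so deleting it lowers the count by exactly one.\<close>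

lemma out_degree_nb_graph:
  assumes "e \<in> parcs G"
  shows "out_degree (with_proj (nb_graph G)) e = out_degree G (snd e) - 1"
  using swap_in_out_arcs[OF assms] finite_out_arcs_with_proj
  by (simp add: out_degree_def out_arcs_nb_graph[OF assms] card_image inj_on_def)

text \<open>Each arc leaves exactly one vertex; this turns estimates at single vertices into one
  over all arcs.\<close>

lemma sum_parcs_by_vertex:
  fixes h :: "'a \<times> 'a \<Rightarrow> 'b::comm_monoid_add"
  shows "(\<Sum>w\<in>pverts G. sum h (out_arcs G w)) = sum h (parcs G)"
  unfolding out_arcs_def with_proj_simps
  by (rule sum.group) (use pair_finite_arcs pair_finite_verts arc_fst_in_verts in \<open>auto simp: image_subset_iff\<close>)

lemma min_degree_le: "v \<in> pverts G \<Longrightarrow> min_degree G \<le> out_degree G v"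
  unfolding min_degree_def using pair_finite_verts by simp

lemma le_max_degree: "v \<in> pverts G \<Longrightarrow> out_degree G v \<le> max_degree G"
  unfolding max_degree_def using pair_finite_verts by simp

section \<open>The global norm estimate\<close>

lemma nb_eigenfun_bound:
  assumes deg: "2 \<le> min_degree G" and f: "nb_eigenfun G \<mu> f"
  shows "1 / (real (max_degree G) - 1) \<le> cmod \<mu>"
proof -
  \<comment> \<open>\<open>K\<close> bounds the factor \<open>\<bar>\<mu>\<bar> (deg w - 1)\<close>
    at every vertex; the claim amounts to \<open>1 \<le> K\<close>.\<close>
  define K where "K = (real (max_degree G) - 1) * cmod \<mu>"
  define F where "F = (\<Sum>e\<in>parcs G. (cmod (f e))\<^sup>2)"
  obtain e0 where e0: "e0 \<in> parcs G" "f e0 \<noteq> 0"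
    using f by (auto simp: nb_eigenfun_def)
  have "2 \<le> max_degree G"
    using deg min_degree_le[OF arc_fst_in_verts[OF e0(1)]] le_max_degree[OF arc_fst_in_verts[OF e0(1)]]
    by linarith
  then have \<Delta>: "real (max_degree G) - 1 > 0" by simp
  have Fpos: "F > 0"
    unfolding F_def using e0 pair_finite_arcs by (intro sum_pos2[of _ e0]) auto
  \<comment> \<open>Incoming arcs at \<open>w\<close> are written as reversals of outgoing ones, so
    both sums range over the same set.\<close>
  have vertex: "(\<Sum>e\<in>out_arcs G w. (cmod (f e))\<^sup>2)
      \<le> (\<Sum>e\<in>out_arcs G w. K\<^sup>2 * (cmod (f (prod.swap e)))\<^sup>2)" if w: "w \<in> pverts G" for w
  proof -
    have d: "2 \<le> card (out_arcs G w)" "card (out_arcs G w) \<le> max_degree G"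
      using deg min_degree_le[OF w] le_max_degree[OF w] by (auto simp: out_degree_def)
    have "(\<Sum>e\<in>out_arcs G w. (cmod (f e))\<^sup>2)
        \<le> (\<Sum>e\<in>out_arcs G w. (cmod (sum f (out_arcs G w) - f e))\<^sup>2)"
      by (rule sum_norm_square_le_sum_minus[OF d(1)])
    also have "\<dots> \<le> (\<Sum>e\<in>out_arcs G w. K\<^sup>2 * (cmod (f (prod.swap e)))\<^sup>2)"
    proof (rule sum_mono)
      fix e assume e: "e \<in> out_arcs G w"
      then have e': "prod.swap e \<in> parcs G" "snd (prod.swap e) = w"
        using swap_in_parcs by (auto simp: out_arcs_def)
      have "sum f (out_arcs G w) - f e = sum f (out_arcs G w - {e})"
        using e finite_out_arcs_with_proj by (simp add: sum_diff1)
      \<comment> \<open>The eigenfunction equation is read at \<open>prod.swap e\<close>, whose head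
        is \<open>w\<close> and whose own reversal is \<open>e\<close>.\<close>
      also have "\<dots> = \<mu> * of_nat (card (out_arcs G w) - 1) * f (prod.swap e)"
        using f e' unfolding nb_eigenfun_def out_degree_def by (metis swap_swap)
      finally have "cmod (sum f (out_arcs G w) - f e)
          = cmod \<mu> * real (card (out_arcs G w) - 1) * cmod (f (prod.swap e))"
        by (simp only: norm_mult norm_of_nat)
      \<comment> \<open>Here the degree at \<open>w\<close> is replaced by the maximum degree, which
        loses nothing in a regular graph.\<close>
      also have "\<dots> \<le> K * cmod (f (prod.swap e))"
        unfolding K_def using d
        by (intro mult_right_mono) (auto simp: mult.commute of_nat_diff intro!: mult_left_mono)
      finally show "(cmod (sum f (out_arcs G w) - f e))\<^sup>2 \<le> K\<^sup>2 * (cmod (f (prod.swap e)))\<^sup>2"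
        by (metis norm_ge_zero power_mono power_mult_distrib)
    qed
    finally show ?thesis .
  qed
  have "F = (\<Sum>w\<in>pverts G. \<Sum>e\<in>out_arcs G w. (cmod (f e))\<^sup>2)"
    by (simp add: F_def sum_parcs_by_vertex)
  also have "\<dots> \<le> (\<Sum>w\<in>pverts G. \<Sum>e\<in>out_arcs G w. K\<^sup>2 * (cmod (f (prod.swap e)))\<^sup>2)"
    by (rule sum_mono) (rule vertex)
  also have "\<dots> = K\<^sup>2 * (\<Sum>e\<in>parcs G. (cmod (f (prod.swap e)))\<^sup>2)"
    by (simp add: sum_parcs_by_vertex sum_distrib_left)
  \<comment> \<open>Reversal permutes the arcs, so the incoming total is again \<open>F\<close>, and
    \<open>F > 0\<close> cancels.\<close>
  also have "(\<Sum>e\<in>parcs G. (cmod (f (prod.swap e)))\<^sup>2) = F"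
    using sum.reindex[of prod.swap "parcs G" "\<lambda>e. (cmod (f e))\<^sup>2"] by (simp add: F_def swap_parcs o_def)
  finally have "1\<^sup>2 \<le> K\<^sup>2"
    using Fpos by simp
  then have "1 \<le> K"
    by (rule power2_le_imp_le) (use \<Delta> in \<open>simp add: K_def\<close>)
  then show ?thesis
    using \<Delta> by (simp add: K_def field_simps)
qed

section \<open>From matrices to functions on arcs\<close>

text \<open>As \<open>es\<close> lists every arc once, \<open>nth\<close> is a bijection from
  positions to arcs, and the 0-1 entries cut the sum down to the successors of
  \<open>e\<close>.\<close>

lemma nb_graph_row_sum:
  fixes f :: "'a \<times> 'a \<Rightarrow> complex"
  assumes es: "distinct es" "set es = parcs G" and e: "e \<in> parcs G"
  shows "(\<Sum>j<length es. (if (e, es ! j) \<in> parcs (nb_graph G) then 1 else 0) * f (es ! j))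
       = sum f (out_arcs G (snd e) - {prod.swap e})"
proof -
  have "(\<Sum>j<length es. (if (e, es ! j) \<in> parcs (nb_graph G) then 1 else 0) * f (es ! j))
      = (\<Sum>e'\<in>parcs G. (if (e, e') \<in> parcs (nb_graph G) then 1 else 0) * f e')"
    by (rule sum.reindex_bij_betw[OF bij_betw_nth]) (use es in auto)
  also have "\<dots> = (\<Sum>e'\<in>{e' \<in> parcs G. (e, e') \<in> parcs (nb_graph G)}. f e')"
    using pair_finite_arcs by (simp add: sum.inter_filter if_distrib[of "\<lambda>x. x * _"] cong: if_cong)
  also have "{e' \<in> parcs G. (e, e') \<in> parcs (nb_graph G)} = out_arcs G (snd e) - {prod.swap e}"
    using e by (auto simp: nb_graph_def out_arcs_def prod.swap_def prod_eq_iff)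
  finally show ?thesis .
qed

lemma outdegree_matrix_nb_graph:
  assumes "set es = parcs G"
  shows "outdegree_matrix es (nb_graph G) = mat (length es) (length es)
    (\<lambda>(i, j). if i = j then of_nat (out_degree G (snd (es ! i)) - 1) else 0)"
proof -
  have "es ! i \<in> parcs G" if "i < length es" for i
    using assms that nth_mem by blast
  then show ?thesis
    unfolding outdegree_matrix_def by (intro cong_mat) (auto simp: out_degree_nb_graph)
qed

text \<open>\<open>mat_inverse\<close> yields \<open>None\<close> only on non-units, so it suffices
  to exhibit some inverse: the diagonal of reciprocals, which exists because minimum degree at least
  2 makes every outdegree positive.\<close>

lemma mat_inverse_outdegree_matrix:
  assumes deg: "2 \<le> min_degree G" and es: "set es = parcs G"
  obtains B where "mat_inverse (outdegree_matrix es (nb_graph G)) = Some B"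
    "outdegree_matrix es (nb_graph G) * B = 1\<^sub>m (length es)"
    "B * outdegree_matrix es (nb_graph G) = 1\<^sub>m (length es)"
    "B \<in> carrier_mat (length es) (length es)"
proof -
  let ?n = "length es"
  define d where "d = (\<lambda>i. of_nat (out_degree G (snd (es ! i)) - 1) :: complex)"
  define D where "D = outdegree_matrix es (nb_graph G)"
  define E where "E = mat ?n ?n (\<lambda>(i, j). if i = j then 1 / d i else 0)"
  have d: "d i \<noteq> 0" if "i < ?n" for i
  proof -
    have "snd (es ! i) \<in> pverts G"
      using that es arc_snd_in_verts nth_mem by blast
    then show ?thesis
      using deg min_degree_le[of "snd (es ! i)"] by (simp add: d_def)
  qed
  have D: "D = mat ?n ?n (\<lambda>(i, j). if i = j then d i else 0)"
    unfolding D_def d_def by (rule outdegree_matrix_nb_graph[OF es])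
  have carr: "D \<in> carrier_mat ?n ?n" "E \<in> carrier_mat ?n ?n"
    by (auto simp: D E_def)
  have "D * E = 1\<^sub>m ?n" "E * D = 1\<^sub>m ?n"
    using d by (auto intro!: eq_matI simp: D E_def scalar_prod_def if_distrib[of "\<lambda>x. x * _"] cong: if_cong)
  then have "D \<in> Units (ring_mat TYPE(complex) ?n ())"
    using carr by (auto simp: Units_def ring_mat_def)
  then obtain B where "mat_inverse D = Some B"
    using mat_inverse(1)[OF carr(1), of "()"] by (cases "mat_inverse D") auto
  with mat_inverse(2)[OF carr(1) this] show ?thesis
    by (intro that[of B]) (auto simp: D_def)
qed

lemma nb_laplacian_carrier:
  assumes "2 \<le> min_degree G" and "set es = parcs G"
  shows "nb_laplacian es G \<in> carrier_mat (length es) (length es)"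
proof -
  obtain B where "mat_inverse (outdegree_matrix es (nb_graph G)) = Some B"
    "B \<in> carrier_mat (length es) (length es)"
    by (rule mat_inverse_outdegree_matrix[OF assms])
  then show ?thesis
    by (auto simp: nb_laplacian_def adjacency_matrix_def)
qed

text \<open>Multiplying by the outdegree matrix clears its inverse, whose entries therefore never
  have to be computed.\<close>

lemma nb_laplacian_mult_vec_eq_iff:
  assumes deg: "2 \<le> min_degree G" and es: "set es = parcs G"
    and v: "v \<in> carrier_vec (length es)"
  shows "nb_laplacian es G *\<^sub>v v = (1 - \<mu>) \<cdot>\<^sub>v v \<longleftrightarrow>
    adjacency_matrix es (nb_graph G) *\<^sub>v v = \<mu> \<cdot>\<^sub>v (outdegree_matrix es (nb_graph G) *\<^sub>v v)"
proof -
  let ?n = "length es"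
  define A where "A = adjacency_matrix es (nb_graph G)"
  define D where "D = outdegree_matrix es (nb_graph G)"
  obtain B where B: "mat_inverse D = Some B" "D * B = 1\<^sub>m ?n" "B * D = 1\<^sub>m ?n" "B \<in> carrier_mat ?n ?n"
    unfolding D_def by (rule mat_inverse_outdegree_matrix[OF deg es])
  have A: "A \<in> carrier_mat ?n ?n" and D: "D \<in> carrier_mat ?n ?n"
    by (auto simp: A_def D_def adjacency_matrix_def outdegree_matrix_def)
  have Av: "A *\<^sub>v v \<in> carrier_vec ?n" and Dv: "D *\<^sub>v v \<in> carrier_vec ?n"
    using A D v by auto
  have "nb_laplacian es G *\<^sub>v v = v - B *\<^sub>v (A *\<^sub>v v)"
    using A B(4) v by (simp add: nb_laplacian_def A_def[symmetric] D_def[symmetric] B(1)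
        minus_mult_distrib_mat_vec[of _ ?n ?n] assoc_mult_mat_vec[of _ ?n ?n _ ?n])
  moreover have "v - B *\<^sub>v (A *\<^sub>v v) = (1 - \<mu>) \<cdot>\<^sub>v v \<longleftrightarrow> B *\<^sub>v (A *\<^sub>v v) = \<mu> \<cdot>\<^sub>v v"
  proof -
    have *: "B *\<^sub>v (A *\<^sub>v v) \<in> carrier_vec ?n"
      using B(4) Av by auto
    show ?thesis
      using v * by (auto simp: vec_eq_iff algebra_simps)
  qed
  moreover have "B *\<^sub>v (A *\<^sub>v v) = \<mu> \<cdot>\<^sub>v v \<longleftrightarrow> A *\<^sub>v v = \<mu> \<cdot>\<^sub>v (D *\<^sub>v v)"
  proof
    assume "B *\<^sub>v (A *\<^sub>v v) = \<mu> \<cdot>\<^sub>v v"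
    then have "D *\<^sub>v (B *\<^sub>v (A *\<^sub>v v)) = \<mu> \<cdot>\<^sub>v (D *\<^sub>v v)"
      using mult_mat_vec[OF D v] by simp
    moreover have "D *\<^sub>v (B *\<^sub>v (A *\<^sub>v v)) = A *\<^sub>v v"
      using assoc_mult_mat_vec[OF D B(4) Av] B(2) Av by simp
    ultimately show "A *\<^sub>v v = \<mu> \<cdot>\<^sub>v (D *\<^sub>v v)" by simp
  next
    assume "A *\<^sub>v v = \<mu> \<cdot>\<^sub>v (D *\<^sub>v v)"
    then have "B *\<^sub>v (A *\<^sub>v v) = \<mu> \<cdot>\<^sub>v (B *\<^sub>v (D *\<^sub>v v))"
      using mult_mat_vec[OF B(4) Dv] by simp
    also have "B *\<^sub>v (D *\<^sub>v v) = v"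
      using assoc_mult_mat_vec[OF B(4) D v] B(3) v by simp
    finally show "B *\<^sub>v (A *\<^sub>v v) = \<mu> \<cdot>\<^sub>v v" .
  qed
  ultimately show ?thesis by (simp add: A_def D_def)
qed

text \<open>Component \<open>i\<close> of the cleared matrix equation is the equation of
  \<open>nb_eigenfun\<close> at the arc \<open>es ! i\<close>, and the vector is nonzero exactly
  when \<open>f\<close> is nonzero on some arc.\<close>

lemma eigenvector_nb_laplacian_iff:
  assumes deg: "2 \<le> min_degree G" and es: "distinct es" "set es = parcs G"
  shows "eigenvector (nb_laplacian es G) (vec (length es) (\<lambda>i. f (es ! i))) (1 - \<mu>)
    \<longleftrightarrow> nb_eigenfun G \<mu> f"
proof -
  let ?n = "length es"
  define v where "v = vec ?n (\<lambda>i. f (es ! i))"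
  have v: "v \<in> carrier_vec ?n" by (simp add: v_def)
  have all: "(\<forall>e\<in>parcs G. P e) \<longleftrightarrow> (\<forall>i<?n. P (es ! i))" for P
    unfolding es(2)[symmetric] set_conv_nth by blast
  have nz: "v \<noteq> 0\<^sub>v ?n \<longleftrightarrow> (\<exists>e\<in>parcs G. f e \<noteq> 0)"
    using all[of "\<lambda>e. f e = 0"] by (auto simp: v_def vec_eq_iff)
  have Av: "(adjacency_matrix es (nb_graph G) *\<^sub>v v) $ i
      = sum f (out_arcs G (snd (es ! i)) - {prod.swap (es ! i)})" if "i < ?n" for i
  proof -
    have "es ! i \<in> parcs G" using es(2) that nth_mem by blast
    from nb_graph_row_sum[OF es this, of f] show ?thesis
      using that by (simp add: v_def adjacency_matrix_def scalar_prod_def lessThan_atLeast0)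
  qed
  have Dv: "(outdegree_matrix es (nb_graph G) *\<^sub>v v) $ i
      = of_nat (out_degree G (snd (es ! i)) - 1) * f (es ! i)" if "i < ?n" for i
    using that unfolding outdegree_matrix_nb_graph[OF es(2)]
    by (simp add: v_def scalar_prod_def if_distrib[of "\<lambda>x. x * _"] cong: if_cong)
  have dims: "dim_row (adjacency_matrix es (nb_graph G)) = ?n"
    "dim_row (outdegree_matrix es (nb_graph G)) = ?n" "dim_row (nb_laplacian es G) = ?n"
    using nb_laplacian_carrier[OF deg es(2)] by (auto simp: adjacency_matrix_def outdegree_matrix_def)
  have "adjacency_matrix es (nb_graph G) *\<^sub>v v = \<mu> \<cdot>\<^sub>v (outdegree_matrix es (nb_graph G) *\<^sub>v v)
    \<longleftrightarrow> (\<forall>i<?n. sum f (out_arcs G (snd (es ! i)) - {prod.swap (es ! i)})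
          = \<mu> * of_nat (out_degree G (snd (es ! i)) - 1) * f (es ! i))"
    \<comment> \<open>\<open>index_mult_mat_vec\<close> would unfold the entries into scalar
      products before \<open>Av\<close> and \<open>Dv\<close> could rewrite them.\<close>
    using dims Av Dv by (auto simp del: index_mult_mat_vec simp: vec_eq_iff mult.assoc)
  then show ?thesis
    unfolding eigenvector_def nb_eigenfun_def all
    using nz v nb_laplacian_mult_vec_eq_iff[OF deg es(2) v, of \<mu>] dims(3)
    by (simp add: v_def all)
qed

lemma eigenvalue_nb_laplacian_iff:
  assumes deg: "2 \<le> min_degree G" and es: "distinct es" "set es = parcs G"
  shows "eigenvalue (nb_laplacian es G) (1 - \<mu>) \<longleftrightarrow> (\<exists>f. nb_eigenfun G \<mu> f)"
proof
  assume "eigenvalue (nb_laplacian es G) (1 - \<mu>)"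
  then obtain v where v: "eigenvector (nb_laplacian es G) v (1 - \<mu>)"
    by (auto simp: eigenvalue_def)
  then have "v \<in> carrier_vec (length es)"
    using nb_laplacian_carrier[OF deg es(2)] by (simp add: eigenvector_def)
  \<comment> \<open>Since \<open>es\<close> is distinct, inverting \<open>nth\<close> recovers the
    position of an arc, so every vector lists the values of a function on arcs.\<close>
  then have "v = vec (length es) (\<lambda>i. v $ the_inv_into {..<length es} ((!) es) (es ! i))"
    using es(1) by (auto simp: vec_eq_iff the_inv_into_f_f inj_on_nth)
  with v eigenvector_nb_laplacian_iff[OF assms, of "\<lambda>e. v $ the_inv_into {..<length es} ((!) es) e"]
  show "\<exists>f. nb_eigenfun G \<mu> f" by auto
next
  assume "\<exists>f. nb_eigenfun G \<mu> f"
  then show "eigenvalue (nb_laplacian es G) (1 - \<mu>)"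
    using eigenvector_nb_laplacian_iff[OF assms] by (auto simp: eigenvalue_def)
qed

section \<open>Bounds on the spectral gap\<close>

lemma spectral_gap_nb_laplacian_ge:
  assumes ne: "pverts G \<noteq> {}" and deg: "2 \<le> min_degree G"
    and es: "distinct es" "set es = parcs G"
  shows "1 / (real (max_degree G) - 1) \<le> spectral_gap_from_1 (nb_laplacian es G)"
proof -
  note carr = nb_laplacian_carrier[OF deg es(2)]
  \<comment> \<open>The minimum needs a nonempty spectrum: a vertex of positive degree gives an arc,
    so the matrix has positive dimension and hence a complex eigenvalue.\<close>
  obtain v where "v \<in> pverts G" using ne by auto
  then have "out_arcs (with_proj G) v \<noteq> {}"
    using deg min_degree_le[of v] by (auto simp: out_degree_def)
  then have "length es > 0"
    using es(2) by (auto simp: out_arcs_def)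
  then have ne: "spectrum (nb_laplacian es G) \<noteq> {}"
    by (rule spectrum_non_empty[OF carr])
  show ?thesis
    unfolding spectral_gap_from_1_def
  proof (rule Min.boundedI)
    fix x assume "x \<in> (\<lambda>l. cmod (1 - l)) ` spectrum (nb_laplacian es G)"
    then obtain l where l: "x = cmod (1 - l)" "eigenvalue (nb_laplacian es G) (1 - (1 - l))"
      by (auto simp: spectrum_def)
    then obtain f where "nb_eigenfun G (1 - l) f"
      using eigenvalue_nb_laplacian_iff[OF deg es] by blast
    then show "1 / (real (max_degree G) - 1) \<le> x"
      using nb_eigenfun_bound[OF deg] l(1) by blast
  qed (use card_finite_spectrum(1)[OF carr] ne in auto)
qed

text \<open>The gap is a minimum over a finite spectrum, so a single eigenfunction bounds it from
  above; sharpness needs only this half.\<close>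

lemma spectral_gap_nb_laplacian_le:
  assumes deg: "2 \<le> min_degree G" and es: "distinct es" "set es = parcs G"
    and f: "nb_eigenfun G \<mu> f"
  shows "spectral_gap_from_1 (nb_laplacian es G) \<le> cmod \<mu>"
proof -
  have "1 - \<mu> \<in> spectrum (nb_laplacian es G)"
    using eigenvalue_nb_laplacian_iff[OF deg es] f by (auto simp: spectrum_def)
  then have "cmod (1 - (1 - \<mu>)) \<in> (\<lambda>l. cmod (1 - l)) ` spectrum (nb_laplacian es G)"
    by (rule imageI)
  then show ?thesis
    unfolding spectral_gap_from_1_def
    using card_finite_spectrum(1)[OF nb_laplacian_carrier[OF deg es(2)]] by simp
qed

end

section \<open>Sharpness on complete graphs\<close>

definition complete_graph :: "nat \<Rightarrow> nat pair_pre_digraph" where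
  "complete_graph n = \<lparr> pverts = {..<n}, parcs = {(u, v). u < n \<and> v < n \<and> u \<noteq> v} \<rparr>"

lemma pair_graph_complete_graph: "pair_graph (complete_graph n)"
proof
  have "parcs (complete_graph n) \<subseteq> {..<n} \<times> {..<n}"
    by (auto simp: complete_graph_def)
  then show "finite (parcs (complete_graph n))"
    by (rule finite_subset) simp
qed (auto simp: complete_graph_def symmetric_def sym_def)

lemma out_arcs_complete_graph:
  "v < n \<Longrightarrow> out_arcs (with_proj (complete_graph n)) v = Pair v ` ({..<n} - {v})"
  by (auto simp: out_arcs_def complete_graph_def)

lemma out_degree_complete_graph:
  "v < n \<Longrightarrow> out_degree (with_proj (complete_graph n)) v = n - 1"
  by (simp add: out_degree_def out_arcs_complete_graph card_image inj_on_def)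

lemma
  assumes "0 < n"
  shows min_degree_complete_graph: "min_degree (complete_graph n) = n - 1"
    and max_degree_complete_graph: "max_degree (complete_graph n) = n - 1"
proof -
  have "out_degree (with_proj (complete_graph n)) ` pverts (complete_graph n) = {n - 1}"
    using assms by (auto simp: complete_graph_def out_degree_complete_graph[unfolded complete_graph_def])
  then show "min_degree (complete_graph n) = n - 1" "max_degree (complete_graph n) = n - 1"
    by (simp_all add: min_degree_def max_degree_def)
qed

text \<open>A unit flow along \<open>0 -> 1 -> 2 -> 0\<close>, antisymmetric under reversal. It is
  defined on all pairs, so one function serves every \<open>n\<close>.\<close>

definition triangle_circulation :: "nat \<times> nat \<Rightarrow> complex" where
  "triangle_circulation e =
     (if e \<in> {(0, 1), (1, 2), (2, 0)} then 1 else if e \<in> {(1, 0), (2, 1), (0, 2)} then - 1 else 0)"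

lemma triangle_circulation_swap: "triangle_circulation (prod.swap e) = - triangle_circulation e"
  by (cases e) (auto simp: triangle_circulation_def)

lemma sum_triangle_circulation:
  assumes "3 \<le> n" "v < n"
  shows "sum triangle_circulation (Pair v ` ({..<n} - {v})) = 0"
proof -
  have "sum triangle_circulation (Pair v ` ({..<n} - {v})) = (\<Sum>u\<in>{..<n} - {v}. triangle_circulation (v, u))"
    by (simp add: sum.reindex inj_on_def)
  \<comment> \<open>All other arcs at \<open>v\<close> carry no flow, and \<open>3 \<le> n\<close>
    keeps the triangle inside the graph.\<close>
  also have "\<dots> = (\<Sum>u\<in>{0, 1, 2} - {v}. triangle_circulation (v, u))"
    by (rule sum.mono_neutral_right) (use assms in \<open>auto simp: triangle_circulation_def\<close>)
  also have "\<dots> = 0"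
  proof -
    consider "v = 0" | "v = 1" | "v = 2" | "v > 2" by linarith
    then show ?thesis
      by cases (auto simp: triangle_circulation_def insert_Diff_if)
  qed
  finally show ?thesis .
qed

text \<open>The net outflow at each vertex is zero, so deleting the reversal of \<open>e\<close>
  from the sum leaves minus its value, which by antisymmetry is the value at \<open>e\<close>. The
  adjacency matrix thus fixes this function, and \<open>\<mu>\<close> is the reciprocal of the
  common outdegree \<open>n - 2\<close>.\<close>

lemma nb_eigenfun_triangle_circulation:
  assumes n: "3 \<le> n"
  shows "nb_eigenfun (complete_graph n) (1 / (of_nat n - 2)) triangle_circulation"
  unfolding nb_eigenfun_def
proof (intro conjI ballI)
  show "\<exists>e\<in>parcs (complete_graph n). triangle_circulation e \<noteq> 0"
    using n by (intro bexI[of _ "(0, 1)"]) (auto simp: complete_graph_def triangle_circulation_def)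
next
  interpret pair_graph "complete_graph n" by (rule pair_graph_complete_graph)
  fix e assume e: "e \<in> parcs (complete_graph n)"
  then have w: "snd e < n" by (auto simp: complete_graph_def)
  have "sum triangle_circulation (out_arcs (with_proj (complete_graph n)) (snd e) - {prod.swap e})
      = - triangle_circulation (prod.swap e)"
    using swap_in_out_arcs[OF e] finite_out_arcs_with_proj sum_triangle_circulation[OF n w]
    by (simp add: sum_diff1 out_arcs_complete_graph[OF w])
  also have "\<dots> = triangle_circulation e"
    by (simp add: triangle_circulation_swap)
  also have "\<dots> = 1 / (of_nat n - 2) * of_nat (out_degree (with_proj (complete_graph n)) (snd e) - 1)
      * triangle_circulation e"
  proof -
    have "of_nat (n - 2) = (of_nat n - 2 :: complex)"
      using n by (simp add: of_nat_diff)
    moreover have "of_nat (n - 2) \<noteq> (0 :: complex)"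
      using n by (simp only: of_nat_eq_0_iff)
    moreover have "n - 1 - 1 = n - 2" by simp
    ultimately show ?thesis
      by (simp only: out_degree_complete_graph[OF w]) simp
  qed
  finally show "sum triangle_circulation (out_arcs (with_proj (complete_graph n)) (snd e) - {prod.swap e})
      = 1 / (of_nat n - 2) * of_nat (out_degree (with_proj (complete_graph n)) (snd e) - 1)
        * triangle_circulation e" .
qed

text \<open>Every vertex has degree \<open>n - 1\<close>, so the general lower bound equals the
  modulus of the \<open>\<mu>\<close> belonging to the triangle circulation.\<close>

lemma spectral_gap_complete_graph:
  assumes n: "3 \<le> n" and es: "distinct es" "set es = parcs (complete_graph n)"
  shows "spectral_gap_from_1 (nb_laplacian es (complete_graph n)) = 1 / (real n - 2)"
proof (rule antisym)
  interpret pair_graph "complete_graph n" by (rule pair_graph_complete_graph)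
  have deg: "2 \<le> min_degree (complete_graph n)" "max_degree (complete_graph n) = n - 1"
    using n by (simp_all add: min_degree_complete_graph max_degree_complete_graph)
  have "cmod (1 / (of_nat n - 2)) = 1 / (real n - 2)"
    using n norm_of_real[of "real n - 2", where 'a = complex] by (simp add: norm_divide)
  with spectral_gap_nb_laplacian_le[OF deg(1) es nb_eigenfun_triangle_circulation[OF n]]
  show "spectral_gap_from_1 (nb_laplacian es (complete_graph n)) \<le> 1 / (real n - 2)"
    by simp
  have "real (max_degree (complete_graph n)) - 1 = real n - 2"
    using n deg(2) by simp
  moreover have "pverts (complete_graph n) \<noteq> {}"
    using n by (simp add: complete_graph_def lessThan_empty_iff bot_nat_def)
  ultimately show "1 / (real n - 2) \<le> spectral_gap_from_1 (nb_laplacian es (complete_graph n))"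
    using spectral_gap_nb_laplacian_ge[OF _ deg(1) es] by (simp only: simp_thms)
qed

theorem theorem4p1:
  shows "(\<forall>(G :: 'a pair_pre_digraph) es.
            pair_graph G \<and> pverts G \<noteq> {} \<and> 2 \<le> min_degree G \<and>
            distinct es \<and> set es = parcs G \<longrightarrow>
              1 / (real (max_degree G) - 1) \<le> spectral_gap_from_1 (nb_laplacian es G))
       \<and> (\<forall>\<Delta> \<ge> 2. \<exists>G :: nat pair_pre_digraph.
            pair_graph G \<and> pverts G \<noteq> {} \<and> 2 \<le> min_degree G \<and> max_degree G = \<Delta> \<and>
            (\<forall>es. distinct es \<and> set es = parcs G \<longrightarrow>
              spectral_gap_from_1 (nb_laplacian es G) = 1 / (real \<Delta> - 1)))"
proof (intro conjI allI impI; (elim conjE)?)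
  fix G :: "'a pair_pre_digraph" and es
  assume "pair_graph G" "pverts G \<noteq> {}" "2 \<le> min_degree G" "distinct es" "set es = parcs G"
  then show "1 / (real (max_degree G) - 1) \<le> spectral_gap_from_1 (nb_laplacian es G)"
    by (rule pair_graph.spectral_gap_nb_laplacian_ge)
next
  fix \<Delta> :: nat assume \<Delta>: "2 \<le> \<Delta>"
  show "\<exists>G :: nat pair_pre_digraph.
      pair_graph G \<and> pverts G \<noteq> {} \<and> 2 \<le> min_degree G \<and> max_degree G = \<Delta> \<and>
      (\<forall>es. distinct es \<and> set es = parcs G \<longrightarrow>
        spectral_gap_from_1 (nb_laplacian es G) = 1 / (real \<Delta> - 1))"
  proof (intro exI conjI allI impI)
    \<comment> \<open>This first goal fixes the witness. With \<open>Suc \<Delta>\<close> vertices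
      every degree is \<open>\<Delta>\<close>, and \<open>real (Suc \<Delta>) - 2\<close> is
      \<open>real \<Delta> - 1\<close>.\<close>
    show "pverts (complete_graph (Suc \<Delta>)) \<noteq> {}"
      by (auto simp: complete_graph_def)
    fix es assume "distinct es \<and> set es = parcs (complete_graph (Suc \<Delta>))"
    then show "spectral_gap_from_1 (nb_laplacian es (complete_graph (Suc \<Delta>))) = 1 / (real \<Delta> - 1)"
      using spectral_gap_complete_graph[of "Suc \<Delta>" es] \<Delta> by simp
  qed (use \<Delta> in \<open>simp_all add: pair_graph_complete_graph min_degree_complete_graph max_degree_complete_graph\<close>)
qed

end
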